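(* Let $\mathcal{H}$ be a quaternionic reproducing kernel Hilbert space of left slice hyperholomorphic functions on the open unit ball $\mathbb{D}\subset\mathbb{H}$ with reproducing kernel $K$ satisfying $K(q,q)>0$ for all $q\in\mathbb{D}$. Fix $i\in\mathbb{S}$ and assume that $J$ is a unitary and anti-selfadjoint operator on $\mathcal{H}$ such that $\mathcal{H}_+^{Ji}=\overline{\operatorname{span}_{\mathbb{C}_i}\{K_q:q\in\mathbb{D}_i\}}$. For $T\in\mathcal{B}_J(\mathcal{H})$ let $\widetilde{T}(q)=\langle k_q,Tk_q\rangle$, $q\in\mathbb{D}_i$, be its Berezin transform. Then, for $T\in\mathcal{B}_J(\mathcal{H})$: (i) if $T$ is self-adjoint, then $\widetilde{T}$ is real-valued; (ii) if $T$ is positive, then $\widetilde{T}$ is non-negative; (iii) $\widetilde{T^*}=\overline{\widetilde{T}}$; (iv) the mapping $T\mapsto\widetilde{T}$ is a contractive $\mathbb{C}_i$-linear mapping from $\mathcal{B}_J(\mathcal{H})$ into $L^\infty(\mathbb{D}_i,\mathbb{H})$.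
   Context: $\mathbb{H}$ denotes the quaternions, $\mathbb{S}=\{x\in\mathbb{H}:\operatorname{Re}(x)=0,\ |x|=1\}$, $\mathbb{C}_i=\{a+ib:a,b\in\mathbb{R}\}$ and $\mathbb{D}_i=\mathbb{D}\cap\mathbb{C}_i$ for $i\in\mathbb{S}$. Every $x\in\mathbb{H}$ is written $x=x_0+i_xx_1$ with $x_0=\operatorname{Re}(x)$, $x_1$ the modulus of the imaginary part, $i_x\in\mathbb{S}$. A real differentiable $f:\mathbb{D}\to\mathbb{H}$ is left slice hyperholomorphic if $f(x)=u(x_0,x_1)+i_xv(x_0,x_1)$ with $\mathbb{H}$-valued $u,v$ satisfying $u(x_0,x_1)=u(x_0,-x_1)$, $v(x_0,x_1)=-v(x_0,-x_1)$, $\partial_{x_0}u=\partial_{x_1}v$ and $\partial_{x_0}v=-\partial_{x_1}u$. A quaternionic Hilbert space is a right $\mathbb{H}$-vector space with a scalar product with values in $\mathbb{H}$ that is positive definite, right linear in the second argument, satisfies $\langle x,y\rangle=\overline{\langle y,x\rangle}$, and is complete for the induced norm (assumed separable). A quaternionic reproducing kernel Hilbert space $\mathcal{H}$ on $\mathbb{D}$ here is a quaternionic Hilbert space of left slice hyperholomorphic functions on $\mathbb{D}$ such that all point evaluations are bounded; $K_w\in\mathcal{H}$ is the unique element with $f(w)=\langle K_w,f\rangle$ for all $f\in\mathcal{H}$, $K(q,w)=K_w(q)$, and $k_q=K_q/\sqrt{K(q,q)}$. $\mathcal{B}(\mathcal{H})$ is the set of bounded right $\mathbb{H}$-linear operators;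 $\langle T^*x,y\rangle=\langle x,Ty\rangle$; $J$ unitary and anti-selfadjoint means $J^*=J^{-1}$ and $J^*=-J$; $T$ is positive if $\langle x,Tx\rangle\ge0$ for all $x$; $\mathcal{B}_J(\mathcal{H})=\{T\in\mathcal{B}(\mathcal{H}):TJ=JT\}$, a complex vector space over $\mathbb{C}_i$ via $(a_0+ia_1)T=a_0T+a_1JT$. $\mathcal{H}_+^{Ji}=\{x\in\mathcal{H}:Jx=xi\}$, a complex Hilbert space over $\mathbb{C}_i$ with right scalar multiplication. $L^\infty(\mathbb{D}_i,\mathbb{H})$ is taken with respect to Lebesgue measure and with left multiplication by scalars from $\mathbb{C}_i$. Contractive means $\|\widetilde T\|_\infty\le\|T\|$. *)

theory Defs
  imports
    "HOL-Analysis.Analysis"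
    "HOL-Library.Function_Algebras"
    "HOL-Probability.Essential_Supremum"
begin

section \<open>Quaternions\<close>

codatatype quat = Quat (qre: real) (qim1: real) (qim2: real) (qim3: real)

lemma quat_eq_iff:
  "x = y \<longleftrightarrow> qre x = qre y \<and> qim1 x = qim1 y \<and> qim2 x = qim2 y \<and> qim3 x = qim3 y"
  by (auto intro: quat.expand)

instantiation quat :: ab_group_add
begin

primcorec zero_quat where
  "qre 0 = 0"
| "qim1 0 = 0"
| "qim2 0 = 0"
| "qim3 0 = 0"

primcorec plus_quat where
  "qre (x + y) = qre x + qre y"
| "qim1 (x + y) = qim1 x + qim1 y"
| "qim2 (x + y) = qim2 x + qim2 y"
| "qim3 (x + y) = qim3 x + qim3 y"

primcorec uminus_quat where
  "qre (- x) = - qre x"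
| "qim1 (- x) = - qim1 x"
| "qim2 (- x) = - qim2 x"
| "qim3 (- x) = - qim3 x"

primcorec minus_quat where
  "qre (x - y) = qre x - qre y"
| "qim1 (x - y) = qim1 x - qim1 y"
| "qim2 (x - y) = qim2 x - qim2 y"
| "qim3 (x - y) = qim3 x - qim3 y"

instance
  by standard (simp_all add: quat_eq_iff)

end

instantiation quat :: ring_1
begin

primcorec one_quat where
  "qre 1 = 1"
| "qim1 1 = 0"
| "qim2 1 = 0"
| "qim3 1 = 0"

primcorec times_quat where
  "qre (x * y) = qre x * qre y - qim1 x * qim1 y - qim2 x * qim2 y - qim3 x * qim3 y"
| "qim1 (x * y) = qre x * qim1 y + qim1 x * qre y + qim2 x * qim3 y - qim3 x * qim2 y"
| "qim2 (x * y) = qre x * qim2 y - qim1 x * qim3 y + qim2 x * qre y + qim3 x * qim1 y"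
| "qim3 (x * y) = qre x * qim3 y + qim1 x * qim2 y - qim2 x * qim1 y + qim3 x * qre y"

instance
  by standard (simp_all add: quat_eq_iff algebra_simps)

end

instantiation quat :: real_algebra_1
begin

primcorec scaleR_quat where
  "qre (scaleR r x) = r * qre x"
| "qim1 (scaleR r x) = r * qim1 x"
| "qim2 (scaleR r x) = r * qim2 x"
| "qim3 (scaleR r x) = r * qim3 x"

instance
  by standard (simp_all add: quat_eq_iff algebra_simps)

end

lemma quat_of_real_sel [simp]:
  "qre (of_real r) = r" "qim1 (of_real r) = 0" "qim2 (of_real r) = 0" "qim3 (of_real r) = 0"
  by (simp_all add: of_real_def)

instantiation quat :: real_inner
begin

definition inner_quat :: "quat \<Rightarrow> quat \<Rightarrow> real" where
  "inner_quat x y = qre x * qre y + qim1 x * qim1 y + qim2 x * qim2 y + qim3 x * qim3 y"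

definition norm_quat :: "quat \<Rightarrow> real" where
  "norm_quat x = sqrt (inner x x)"

definition sgn_quat :: "quat \<Rightarrow> quat" where
  "sgn_quat x = x /\<^sub>R norm x"

definition dist_quat :: "quat \<Rightarrow> quat \<Rightarrow> real" where
  "dist_quat x y = norm (x - y)"

definition uniformity_quat :: "(quat \<times> quat) filter" where
  "uniformity_quat = (INF e\<in>{0 <..}. principal {(x, y). dist x y < e})"

definition open_quat :: "quat set \<Rightarrow> bool" where
  "open_quat U \<longleftrightarrow> (\<forall>x\<in>U. eventually (\<lambda>(x', y). x' = x \<longrightarrow> y \<in> U) uniformity)"

instance
proof
  fix x y z :: quat and r :: real
  show "inner x y = inner y x"
    by (simp add: inner_quat_def mult.commute)
  show "inner (x + y) z = inner x z + inner y z"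
    by (simp add: inner_quat_def algebra_simps)
  show "inner (r *\<^sub>R x) y = r * inner x y"
    by (simp add: inner_quat_def algebra_simps)
  show "0 \<le> inner x x"
    by (simp add: inner_quat_def)
  show "inner x x = 0 \<longleftrightarrow> x = 0"
  proof
    assume "inner x x = 0"
    then have "(qre x)\<^sup>2 + (qim1 x)\<^sup>2 + (qim2 x)\<^sup>2 + (qim3 x)\<^sup>2 = 0"
      by (simp add: inner_quat_def power2_eq_square)
    moreover have "0 \<le> (qre x)\<^sup>2" "0 \<le> (qim1 x)\<^sup>2" "0 \<le> (qim2 x)\<^sup>2" "0 \<le> (qim3 x)\<^sup>2"
      by simp_all
    ultimately have "(qre x)\<^sup>2 = 0" "(qim1 x)\<^sup>2 = 0" "(qim2 x)\<^sup>2 = 0" "(qim3 x)\<^sup>2 = 0"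
      by linarith+
    then show "x = 0"
      by (simp add: quat_eq_iff)
  qed (simp add: inner_quat_def)
qed (rule norm_quat_def sgn_quat_def dist_quat_def uniformity_quat_def open_quat_def)+

end

lemma norm_quat_eq: "norm x = sqrt ((qre x)\<^sup>2 + (qim1 x)\<^sup>2 + (qim2 x)\<^sup>2 + (qim3 x)\<^sup>2)"
  by (simp add: norm_quat_def inner_quat_def power2_eq_square)

primcorec qcnj :: "quat \<Rightarrow> quat" where
  "qre (qcnj x) = qre x"
| "qim1 (qcnj x) = - qim1 x"
| "qim2 (qcnj x) = - qim2 x"
| "qim3 (qcnj x) = - qim3 x"

lemma quat_mult_cnj: "x * qcnj x = of_real ((norm x)\<^sup>2)" "qcnj x * x = of_real ((norm x)\<^sup>2)"
  by (simp_all add: quat_eq_iff norm_quat_eq) (simp_all add: power2_eq_square)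

instantiation quat :: real_normed_div_algebra
begin

definition inverse_quat :: "quat \<Rightarrow> quat" where
  "inverse_quat x = qcnj x /\<^sub>R (norm x)\<^sup>2"

definition divide_quat :: "quat \<Rightarrow> quat \<Rightarrow> quat" where
  "divide_quat x y = x * inverse y"

instance
proof
  fix x y :: quat
  show "x \<noteq> 0 \<Longrightarrow> inverse x * x = 1"
    by (simp add: inverse_quat_def quat_mult_cnj of_real_def del: of_real_power)
  show "x \<noteq> 0 \<Longrightarrow> x * inverse x = 1"
    by (simp add: inverse_quat_def quat_mult_cnj of_real_def del: of_real_power)
  show "inverse (0::quat) = 0"
    by (simp add: inverse_quat_def quat_eq_iff)
  show "norm (x * y) = norm x * norm y"
    unfolding norm_quat_eq real_sqrt_mult [symmetric]
    by (rule arg_cong [where f = sqrt]) (simp add: power2_eq_square algebra_simps)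
qed (rule divide_quat_def)

end

instantiation quat :: euclidean_space
begin

definition Basis_quat :: "quat set" where
  "Basis_quat = {Quat 1 0 0 0, Quat 0 1 0 0, Quat 0 0 1 0, Quat 0 0 0 1}"

instance
proof
  fix u v x :: quat
  show "(Basis :: quat set) \<noteq> {}" and "finite (Basis :: quat set)"
    by (simp_all add: Basis_quat_def)
  show "u \<in> Basis \<Longrightarrow> v \<in> Basis \<Longrightarrow> inner u v = (if u = v then 1 else 0)"
    unfolding Basis_quat_def by (elim insertE emptyE) (simp_all add: inner_quat_def)
  show "(\<forall>u\<in>Basis. inner x u = 0) \<longleftrightarrow> x = 0"
    unfolding quat_eq_iff by (simp add: Basis_quat_def inner_quat_def)
qed

end

definition imag_units :: "quat set" where
  "imag_units = {x. qre x = 0 \<and> norm x = 1}"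

definition qdisc :: "quat set" where
  "qdisc = ball 0 1"

definition slice :: "quat \<Rightarrow> quat set" where
  "slice i = {of_real a + i * of_real b |a b. True}"

definition slice_disc :: "quat \<Rightarrow> quat set" where
  "slice_disc i = qdisc \<inter> slice i"


section \<open>Slice hyperholomorphic functions\<close>

definition im_modulus :: "quat \<Rightarrow> real" where
  "im_modulus x = norm (x - of_real (qre x))"

text \<open>
  The functions \<open>u\<close> and \<open>v\<close> live on the open unit disc of the \<open>(a, b)\<close>-plane, including
  \<open>b < 0\<close>. For real \<open>x\<close> every \<open>j\<close> in the sphere is admissible below; this causes no ambiguity since
  \<open>v a 0 = 0\<close>.
\<close>

definition left_slice_hyperholomorphic :: "(quat \<Rightarrow> quat) \<Rightarrow> bool" where
  "left_slice_hyperholomorphic f \<longleftrightarrow>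
     (\<forall>x\<in>qdisc. f differentiable (at x)) \<and>
     (\<exists>u v :: real \<Rightarrow> real \<Rightarrow> quat.
        (\<forall>x\<in>qdisc. \<forall>j\<in>imag_units. x = of_real (qre x) + j * of_real (im_modulus x) \<longrightarrow>
           f x = u (qre x) (im_modulus x) + j * v (qre x) (im_modulus x)) \<and>
        (\<forall>a b. a\<^sup>2 + b\<^sup>2 < 1 \<longrightarrow>
           u a b = u a (- b) \<and> v a b = - v a (- b) \<and>
           (\<exists>d. ((\<lambda>s. u s b) has_vector_derivative d) (at a) \<and>
                ((\<lambda>t. v a t) has_vector_derivative d) (at b)) \<and>
           (\<exists>d. ((\<lambda>s. v s b) has_vector_derivative d) (at a) \<and>
                ((\<lambda>t. u a t) has_vector_derivative - d) (at b))))"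


section \<open>Quaternionic Hilbert spaces\<close>

class right_quat_space = ab_group_add +
  fixes scaleQ :: "'a \<Rightarrow> quat \<Rightarrow> 'a"  (infixl \<open>*\<^sub>Q\<close> 75)
  assumes scaleQ_add_left: "(x + y) *\<^sub>Q a = x *\<^sub>Q a + y *\<^sub>Q a"
    and scaleQ_add_right: "x *\<^sub>Q (a + b) = x *\<^sub>Q a + x *\<^sub>Q b"
    and scaleQ_mult: "x *\<^sub>Q (a * b) = x *\<^sub>Q a *\<^sub>Q b"
    and scaleQ_one: "x *\<^sub>Q 1 = x"

instantiation quat :: right_quat_space
begin

definition scaleQ_quat :: "quat \<Rightarrow> quat \<Rightarrow> quat" where
  "scaleQ_quat x a = x * a"

instance
  by standard (simp_all add: scaleQ_quat_def algebra_simps)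

end

instantiation "fun" :: (type, right_quat_space) right_quat_space
begin

definition scaleQ_fun :: "('a \<Rightarrow> 'b) \<Rightarrow> quat \<Rightarrow> 'a \<Rightarrow> 'b" where
  "scaleQ_fun f a = (\<lambda>x. f x *\<^sub>Q a)"

instance
  by standard
    (simp_all add: scaleQ_fun_def fun_eq_iff scaleQ_add_left scaleQ_add_right scaleQ_mult scaleQ_one)

end

definition quat_subspace :: "'a::right_quat_space set \<Rightarrow> bool" where
  "quat_subspace V \<longleftrightarrow> 0 \<in> V \<and> (\<forall>x\<in>V. \<forall>y\<in>V. x + y \<in> V) \<and> (\<forall>x\<in>V. \<forall>a. x *\<^sub>Q a \<in> V)"

definition ip_norm :: "('a \<Rightarrow> 'a \<Rightarrow> quat) \<Rightarrow> 'a \<Rightarrow> real" where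
  "ip_norm ip x = sqrt (qre (ip x x))"

definition ip_closure :: "'a::ab_group_add set \<Rightarrow> ('a \<Rightarrow> 'a \<Rightarrow> quat) \<Rightarrow> 'a set \<Rightarrow> 'a set" where
  "ip_closure V ip S = {x\<in>V. \<forall>e>0. \<exists>y\<in>S. ip_norm ip (x - y) < e}"

definition quat_hilbert_space ::
    "'a::right_quat_space set \<Rightarrow> ('a \<Rightarrow> 'a \<Rightarrow> quat) \<Rightarrow> bool" where
  "quat_hilbert_space V ip \<longleftrightarrow>
     quat_subspace V \<and>
     (\<forall>x\<in>V. ip x x \<in> \<real>\<^sub>\<ge>\<^sub>0 \<and> (ip x x = 0 \<longleftrightarrow> x = 0)) \<and>
     (\<forall>x\<in>V. \<forall>y\<in>V. \<forall>z\<in>V. \<forall>a b. ip x (y *\<^sub>Q a + z *\<^sub>Q b) = ip x y * a + ip x z * b) \<and>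
     (\<forall>x\<in>V. \<forall>y\<in>V. ip x y = qcnj (ip y x)) \<and>
     (\<forall>X :: nat \<Rightarrow> 'a. range X \<subseteq> V \<longrightarrow>
        (\<forall>e>0. \<exists>N. \<forall>m\<ge>N. \<forall>n\<ge>N. ip_norm ip (X m - X n) < e) \<longrightarrow>
        (\<exists>x\<in>V. (\<lambda>n. ip_norm ip (X n - x)) \<longlonglongrightarrow> 0)) \<and>
     (\<exists>S. countable S \<and> S \<subseteq> V \<and> ip_closure V ip S = V)"

text \<open>Operators on \<open>V\<close> are represented by functions that vanish outside \<open>V\<close>.\<close>

definition bounded_ops ::
    "'a::right_quat_space set \<Rightarrow> ('a \<Rightarrow> 'a \<Rightarrow> quat) \<Rightarrow> ('a \<Rightarrow> 'a) set" where
  "bounded_ops V ip = {T.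
     (\<forall>x\<in>V. T x \<in> V) \<and> (\<forall>x. x \<notin> V \<longrightarrow> T x = 0) \<and>
     (\<forall>x\<in>V. \<forall>y\<in>V. T (x + y) = T x + T y) \<and>
     (\<forall>x\<in>V. \<forall>a. T (x *\<^sub>Q a) = T x *\<^sub>Q a) \<and>
     (\<exists>C. \<forall>x\<in>V. ip_norm ip (T x) \<le> C * ip_norm ip x)}"

definition op_norm ::
    "'a set \<Rightarrow> ('a \<Rightarrow> 'a \<Rightarrow> quat) \<Rightarrow> ('a \<Rightarrow> 'a) \<Rightarrow> real" where
  "op_norm V ip T = (SUP x\<in>{x\<in>V. ip_norm ip x \<le> 1}. ip_norm ip (T x))"

definition adj ::
    "'a::zero set \<Rightarrow> ('a \<Rightarrow> 'a \<Rightarrow> quat) \<Rightarrow> ('a \<Rightarrow> 'a) \<Rightarrow> 'a \<Rightarrow> 'a" where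
  "adj V ip T x = (if x \<in> V then THE z. z \<in> V \<and> (\<forall>y\<in>V. ip z y = ip x (T y)) else 0)"

definition selfadjoint_op ::
    "'a::zero set \<Rightarrow> ('a \<Rightarrow> 'a \<Rightarrow> quat) \<Rightarrow> ('a \<Rightarrow> 'a) \<Rightarrow> bool" where
  "selfadjoint_op V ip T \<longleftrightarrow> adj V ip T = T"

definition anti_selfadjoint_op ::
    "'a::ab_group_add set \<Rightarrow> ('a \<Rightarrow> 'a \<Rightarrow> quat) \<Rightarrow> ('a \<Rightarrow> 'a) \<Rightarrow> bool" where
  "anti_selfadjoint_op V ip T \<longleftrightarrow> adj V ip T = - T"

definition unitary_op ::
    "'a::zero set \<Rightarrow> ('a \<Rightarrow> 'a \<Rightarrow> quat) \<Rightarrow> ('a \<Rightarrow> 'a) \<Rightarrow> bool" where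
  "unitary_op V ip T \<longleftrightarrow> (\<forall>x\<in>V. adj V ip T (T x) = x \<and> T (adj V ip T x) = x)"

definition positive_op ::
    "'a set \<Rightarrow> ('a \<Rightarrow> 'a \<Rightarrow> quat) \<Rightarrow> ('a \<Rightarrow> 'a) \<Rightarrow> bool" where
  "positive_op V ip T \<longleftrightarrow> (\<forall>x\<in>V. ip x (T x) \<in> \<real>\<^sub>\<ge>\<^sub>0)"

definition commuting_ops ::
    "'a::right_quat_space set \<Rightarrow> ('a \<Rightarrow> 'a \<Rightarrow> quat) \<Rightarrow> ('a \<Rightarrow> 'a) \<Rightarrow> ('a \<Rightarrow> 'a) set" where
  "commuting_ops V ip J = {T \<in> bounded_ops V ip. T \<circ> J = J \<circ> T}"

text \<open>
  The operator \<open>(a + i b) T = a T + b J T\<close>. Real scalars are central, so that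
  \<open>(a T) x = (T x) a\<close>.
\<close>

definition scale_op ::
    "('a::right_quat_space \<Rightarrow> 'a) \<Rightarrow> real \<Rightarrow> real \<Rightarrow> ('a \<Rightarrow> 'a) \<Rightarrow> 'a \<Rightarrow> 'a" where
  "scale_op J a b T = (\<lambda>x. T x *\<^sub>Q of_real a + J (T x) *\<^sub>Q of_real b)"

definition plus_eigenspace ::
    "'a::right_quat_space set \<Rightarrow> ('a \<Rightarrow> 'a) \<Rightarrow> quat \<Rightarrow> 'a set" where
  "plus_eigenspace V J i = {x\<in>V. J x = x *\<^sub>Q i}"

definition slice_span :: "quat \<Rightarrow> 'a::right_quat_space set \<Rightarrow> 'a set" where
  "slice_span i S = {(\<Sum>x\<in>F. x *\<^sub>Q c x) |F c. finite F \<and> F \<subseteq> S \<and> (\<forall>x\<in>F. c x \<in> slice i)}"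


section \<open>Reproducing kernels and the Berezin transform\<close>

text \<open>
  A function on the unit ball is represented by its extension by \<open>0\<close> to all quaternions; the linear
  structure is the pointwise one.
\<close>

definition slice_rkhs ::
    "(quat \<Rightarrow> quat) set \<Rightarrow> ((quat \<Rightarrow> quat) \<Rightarrow> (quat \<Rightarrow> quat) \<Rightarrow> quat) \<Rightarrow> bool" where
  "slice_rkhs H ip \<longleftrightarrow>
     quat_hilbert_space H ip \<and>
     (\<forall>f\<in>H. left_slice_hyperholomorphic f \<and> (\<forall>x. x \<notin> qdisc \<longrightarrow> f x = 0)) \<and>
     (\<forall>w\<in>qdisc. \<exists>C. \<forall>f\<in>H. norm (f w) \<le> C * ip_norm ip f)"

definition kernel_fun ::
    "(quat \<Rightarrow> quat) set \<Rightarrow> ((quat \<Rightarrow> quat) \<Rightarrow> (quat \<Rightarrow> quat) \<Rightarrow> quat) \<Rightarrow> quat \<Rightarrow> quat \<Rightarrow> quat"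
  where
  "kernel_fun H ip w = (THE k. k \<in> H \<and> (\<forall>f\<in>H. f w = ip k f))"

definition rep_kernel ::
    "(quat \<Rightarrow> quat) set \<Rightarrow> ((quat \<Rightarrow> quat) \<Rightarrow> (quat \<Rightarrow> quat) \<Rightarrow> quat) \<Rightarrow> quat \<Rightarrow> quat \<Rightarrow> quat"
  where
  "rep_kernel H ip q w = kernel_fun H ip w q"

definition normalized_kernel_fun ::
    "(quat \<Rightarrow> quat) set \<Rightarrow> ((quat \<Rightarrow> quat) \<Rightarrow> (quat \<Rightarrow> quat) \<Rightarrow> quat) \<Rightarrow> quat \<Rightarrow> quat \<Rightarrow> quat"
  where
  "normalized_kernel_fun H ip q =
     kernel_fun H ip q *\<^sub>Q of_real (1 / sqrt (qre (rep_kernel H ip q q)))"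

definition berezin ::
    "(quat \<Rightarrow> quat) set \<Rightarrow> ((quat \<Rightarrow> quat) \<Rightarrow> (quat \<Rightarrow> quat) \<Rightarrow> quat) \<Rightarrow>
     ((quat \<Rightarrow> quat) \<Rightarrow> (quat \<Rightarrow> quat)) \<Rightarrow> quat \<Rightarrow> quat"
  where
  "berezin H ip T q = ip (normalized_kernel_fun H ip q) (T (normalized_kernel_fun H ip q))"


section \<open>Essentially bounded functions on a slice of the ball\<close>

text \<open>
  Planar Lebesgue measure on \<open>slice_disc i\<close>, transported from the complex unit disc along
  \<open>a + \<i> b \<mapsto> a + i b\<close>. Elements of \<open>L\<^sup>\<infinity>\<close> are given by representatives.
\<close>

definition slice_embed :: "quat \<Rightarrow> complex \<Rightarrow> quat" where
  "slice_embed i z = of_real (Re z) + i * of_real (Im z)"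

definition slice_lebesgue :: "quat \<Rightarrow> quat measure" where
  "slice_lebesgue i = embed_measure (lebesgue_on (ball 0 1)) (slice_embed i)"

definition Linf_norm :: "quat measure \<Rightarrow> (quat \<Rightarrow> quat) \<Rightarrow> ereal" where
  "Linf_norm M g = esssup M (\<lambda>q. ereal (norm (g q)))"

definition Linf :: "quat measure \<Rightarrow> (quat \<Rightarrow> quat) set" where
  "Linf M = {g. g \<in> borel_measurable M \<and> Linf_norm M g < \<infinity>}"

lemma imag_unit_square:
  assumes "i \<in> imag_units"
  shows "i * i = - 1"
  using assms
  by (auto simp add: imag_units_def quat_eq_iff norm_quat_eq power2_eq_square)

lemma norm_slice_embed:
  assumes "i \<in> imag_units"
  shows "norm (slice_embed i z) = cmod z"
proof -
  have i: "qre i = 0" "(qim1 i)\<^sup>2 + (qim2 i)\<^sup>2 + (qim3 i)\<^sup>2 = 1"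
    using assms by (auto simp: imag_units_def norm_quat_eq)
  have "(Re z)\<^sup>2 + (qim1 i * Im z)\<^sup>2 + (qim2 i * Im z)\<^sup>2 + (qim3 i * Im z)\<^sup>2 =
      (Re z)\<^sup>2 + ((qim1 i)\<^sup>2 + (qim2 i)\<^sup>2 + (qim3 i)\<^sup>2) * (Im z)\<^sup>2"
    by (simp add: power_mult_distrib algebra_simps)
  then show ?thesis
    using i by (simp add: norm_quat_eq cmod_def slice_embed_def)
qed

lemma space_slice_lebesgue:
  assumes "i \<in> imag_units"
  shows "space (slice_lebesgue i) = slice_disc i"
proof -
  have "slice_embed i ` ball 0 1 = slice_disc i"
  proof
    show "slice_embed i ` ball 0 1 \<subseteq> slice_disc i"
      using norm_slice_embed [OF assms]
      by (auto simp: slice_disc_def qdisc_def slice_def slice_embed_def)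
    show "slice_disc i \<subseteq> slice_embed i ` ball 0 1"
    proof
      fix x assume x: "x \<in> slice_disc i"
      then obtain a b where "x = slice_embed i (Complex a b)"
        by (auto simp: slice_disc_def slice_def slice_embed_def)
      with x norm_slice_embed [OF assms] show "x \<in> slice_embed i ` ball 0 1"
        by (auto simp: slice_disc_def qdisc_def)
    qed
  qed
  then show ?thesis
    by (simp add: slice_lebesgue_def space_embed_measure)
qed

lemma inj_slice_embed:
  assumes "i \<in> imag_units"
  shows "inj (slice_embed i)"
proof (rule injI)
  fix z w assume "slice_embed i z = slice_embed i w"
  moreover have "slice_embed i (z - w) = slice_embed i z - slice_embed i w"
    by (simp add: slice_embed_def algebra_simps)
  ultimately have "norm (slice_embed i (z - w)) = 0"
    by simp
  then show "z = w"
    by (simp add: norm_slice_embed [OF assms])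
qed

end

theory Submission
  imports Defs
begin

text \<open>
  Riesz representation supplies kernel functions and adjoints; reality, positivity and
  compatibility with adjoints are then symmetries of the inner product, and contractivity is
  Cauchy--Schwarz for the unit vectors \<open>k\<^sub>q\<close>. Since \<open>k\<^sub>q\<close> lies in the eigenspace \<open>J x = x i\<close>, one has
  \<open>\<langle>k\<^sub>q, J T k\<^sub>q\<rangle> = \<langle>- J k\<^sub>q, T k\<^sub>q\<rangle> = i \<langle>k\<^sub>q, T k\<^sub>q\<rangle>\<close>, which is complex linearity. The Berezin transform is
  measurable because it is a diagonal restriction of a separately continuous function.
\<close>


section \<open>Quaternionic conjugation\<close>

lemma qcnj_simps [simp]:
  "qcnj (qcnj x) = x" "qcnj (x + y) = qcnj x + qcnj y" "qcnj (x * y) = qcnj y * qcnj x"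
  "qcnj (of_real r) = of_real r" "qcnj 0 = 0" "qcnj (- x) = - qcnj x"
  by (simp_all add: quat_eq_iff algebra_simps)

lemma norm_qcnj [simp]: "norm (qcnj x) = norm x"
  by (simp add: norm_quat_eq)

lemma abs_qre_le_norm: "\<bar>qre x\<bar> \<le> norm x"
  unfolding norm_quat_eq by (rule real_le_rsqrt) (simp add: power2_eq_square)

text \<open>For a self-adjoint operator this turns the conjugation rule for Berezin transforms of
  adjoints into reality.\<close>

lemma Reals_iff_qcnj_eq: "x \<in> \<real> \<longleftrightarrow> qcnj x = x" for x :: quat
proof
  assume "qcnj x = x"
  then have "x = of_real (qre x)"
    by (simp add: quat_eq_iff)
  then show "x \<in> \<real>"
    by (metis Reals_of_real)
qed (auto elim!: Reals_cases)

lemma nonneg_Reals_eq_of_real_qre: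
  assumes "x \<in> \<real>\<^sub>\<ge>\<^sub>0"
  shows "x = of_real (qre x)" "0 \<le> qre x"
  using assms by (auto elim!: nonneg_Reals_cases)

lemma of_real_commute_quat: "x * of_real r = of_real r * (x :: quat)"
  by (simp add: quat_eq_iff)

lemma continuous_on_qre: "continuous_on A qre"
proof -
  have qre_eq: "qre = (\<lambda>x. inner x (1 :: quat))"
    by (simp add: fun_eq_iff inner_quat_def)
  show ?thesis
    by (subst qre_eq) (intro continuous_intros)
qed

lemma bounded_linear_qcnj: "bounded_linear qcnj"
  by (rule bounded_linear_intro [where K = 1]) (simp_all add: quat_eq_iff)

lemma continuous_on_slice_embed: "continuous_on A (slice_embed i)"
  unfolding slice_embed_def by (intro continuous_intros)


section \<open>Right quaternionic vector spaces\<close>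

lemma scaleQ_zero_right [simp]: "x *\<^sub>Q 0 = 0" for x :: "'a::right_quat_space"
  using scaleQ_add_right [of x 0 0] by simp

lemma scaleQ_minus_right: "x *\<^sub>Q (- a) = - (x *\<^sub>Q a)" for x :: "'a::right_quat_space"
  using scaleQ_add_right [of x a "- a"] by (simp add: eq_neg_iff_add_eq_0 add.commute)

lemma scaleQ_minus_one: "x *\<^sub>Q (- 1) = - x" for x :: "'a::right_quat_space"
  by (simp add: scaleQ_minus_right scaleQ_one)


section \<open>Quaternionic Hilbert spaces\<close>

locale quat_hilbert =
  fixes V :: "'a::right_quat_space set" and ip :: "'a \<Rightarrow> 'a \<Rightarrow> quat"
  assumes hilbert: "quat_hilbert_space V ip"
begin

abbreviation nrm :: "'a \<Rightarrow> real" where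
  "nrm \<equiv> ip_norm ip"

lemma subspace: "quat_subspace V"
  using hilbert unfolding quat_hilbert_space_def by blast

lemma zero_mem [simp]: "0 \<in> V"
  using subspace by (simp add: quat_subspace_def)

lemma add_mem [simp]: "x \<in> V \<Longrightarrow> y \<in> V \<Longrightarrow> x + y \<in> V"
  using subspace by (simp add: quat_subspace_def)

lemma scaleQ_mem [simp]: "x \<in> V \<Longrightarrow> x *\<^sub>Q a \<in> V"
  using subspace by (simp add: quat_subspace_def)

lemma minus_mem [simp]: "x \<in> V \<Longrightarrow> - x \<in> V"
  using scaleQ_mem [of x "- 1"] by (simp add: scaleQ_minus_one)

lemma diff_mem [simp]: "x \<in> V \<Longrightarrow> y \<in> V \<Longrightarrow> x - y \<in> V"
  using add_mem [of x "- y"] by simp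

lemma ip_self_nonneg: "x \<in> V \<Longrightarrow> ip x x \<in> \<real>\<^sub>\<ge>\<^sub>0"
  using hilbert unfolding quat_hilbert_space_def by blast

lemma ip_self_eq_0: "x \<in> V \<Longrightarrow> ip x x = 0 \<longleftrightarrow> x = 0"
  using hilbert unfolding quat_hilbert_space_def by blast

lemma ip_cnj: "x \<in> V \<Longrightarrow> y \<in> V \<Longrightarrow> ip x y = qcnj (ip y x)"
  using hilbert unfolding quat_hilbert_space_def by blast

lemma ip_linear:
  "x \<in> V \<Longrightarrow> y \<in> V \<Longrightarrow> z \<in> V \<Longrightarrow> ip x (y *\<^sub>Q a + z *\<^sub>Q b) = ip x y * a + ip x z * b"
  using hilbert unfolding quat_hilbert_space_def by blast

lemma complete:
  assumes "range X \<subseteq> V" and "\<And>e. e > 0 \<Longrightarrow> \<exists>N. \<forall>m\<ge>N. \<forall>n\<ge>N. nrm (X m - X n) < e"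
  obtains x where "x \<in> V" "(\<lambda>n. nrm (X n - x)) \<longlonglongrightarrow> 0"
proof -
  have "\<forall>X :: nat \<Rightarrow> 'a. range X \<subseteq> V \<longrightarrow>
        (\<forall>e>0. \<exists>N. \<forall>m\<ge>N. \<forall>n\<ge>N. nrm (X m - X n) < e) \<longrightarrow>
        (\<exists>x\<in>V. (\<lambda>n. nrm (X n - x)) \<longlonglongrightarrow> 0)"
    using hilbert unfolding quat_hilbert_space_def by (elim conjE)
  from this [rule_format, of X] assms show ?thesis
    using that by blast
qed

section \<open>Sesquilinearity of the inner product\<close>

lemma ip_add_right: "x \<in> V \<Longrightarrow> y \<in> V \<Longrightarrow> z \<in> V \<Longrightarrow> ip x (y + z) = ip x y + ip x z"
  using ip_linear [of x y z 1 1] by (simp add: scaleQ_one)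

lemma ip_scaleQ_right: "x \<in> V \<Longrightarrow> y \<in> V \<Longrightarrow> ip x (y *\<^sub>Q a) = ip x y * a"
  using ip_linear [of x y 0 a 0] by simp

lemma ip_minus_right: "x \<in> V \<Longrightarrow> y \<in> V \<Longrightarrow> ip x (- y) = - ip x y"
  using ip_scaleQ_right [of x y "- 1"] by (simp add: scaleQ_minus_one)

lemma ip_diff_right: "x \<in> V \<Longrightarrow> y \<in> V \<Longrightarrow> z \<in> V \<Longrightarrow> ip x (y - z) = ip x y - ip x z"
  using ip_add_right [of x y "- z"] by (simp add: ip_minus_right)

lemma ip_add_left: "x \<in> V \<Longrightarrow> y \<in> V \<Longrightarrow> z \<in> V \<Longrightarrow> ip (x + y) z = ip x z + ip y z"
  using ip_cnj [of "x + y" z] ip_cnj [of x z] ip_cnj [of y z] by (simp add: ip_add_right)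

lemma ip_scaleQ_left: "x \<in> V \<Longrightarrow> y \<in> V \<Longrightarrow> ip (x *\<^sub>Q a) y = qcnj a * ip x y"
  using ip_cnj [of "x *\<^sub>Q a" y] ip_cnj [of x y] by (simp add: ip_scaleQ_right)

lemma ip_minus_left: "x \<in> V \<Longrightarrow> y \<in> V \<Longrightarrow> ip (- x) y = - ip x y"
  using ip_cnj [of "- x" y] ip_cnj [of x y] by (simp add: ip_minus_right)

lemma ip_diff_left: "x \<in> V \<Longrightarrow> y \<in> V \<Longrightarrow> z \<in> V \<Longrightarrow> ip (x - y) z = ip x z - ip y z"
  using ip_add_left [of x "- y" z] by (simp add: ip_minus_left)

lemmas ip_simps = ip_add_right ip_scaleQ_right ip_minus_right ip_diff_right
  ip_add_left ip_scaleQ_left ip_minus_left ip_diff_left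

section \<open>The induced norm and the Cauchy--Schwarz inequality\<close>

lemma qre_ip_commute: "x \<in> V \<Longrightarrow> y \<in> V \<Longrightarrow> qre (ip x y) = qre (ip y x)"
  by (simp add: ip_cnj [of x y])

lemma ip_self: "x \<in> V \<Longrightarrow> ip x x = of_real ((nrm x)\<^sup>2)"
  using nonneg_Reals_eq_of_real_qre [OF ip_self_nonneg, of x] by (simp add: ip_norm_def)

lemma qre_ip_self: "x \<in> V \<Longrightarrow> qre (ip x x) = (nrm x)\<^sup>2"
  by (simp add: ip_self del: of_real_power)

lemma nrm_nonneg [simp]: "x \<in> V \<Longrightarrow> 0 \<le> nrm x"
  using nonneg_Reals_eq_of_real_qre(2) [OF ip_self_nonneg, of x] by (simp add: ip_norm_def)

lemma nrm_zero [simp]: "nrm 0 = 0"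
  using ip_self_eq_0 [of 0] by (simp add: ip_norm_def)

lemma nrm_eq_0: "x \<in> V \<Longrightarrow> nrm x = 0 \<longleftrightarrow> x = 0"
  using ip_self [of x] ip_self_eq_0 [of x] by (auto simp del: of_real_power)

text \<open>The value \<open>ip x x\<close> is real, hence central, so it can be pulled out of
  \<open>qcnj a * ip x x * a\<close>, leaving \<open>qcnj a * a\<close>.\<close>

lemma nrm_scaleQ: "x \<in> V \<Longrightarrow> nrm (x *\<^sub>Q a) = nrm x * norm a"
proof -
  assume x: "x \<in> V"
  have "ip (x *\<^sub>Q a) (x *\<^sub>Q a) = qcnj a * of_real ((nrm x)\<^sup>2) * a"
    using x by (simp add: ip_simps ip_self [OF x] mult.assoc)
  also have "\<dots> = of_real ((nrm x)\<^sup>2) * of_real ((norm a)\<^sup>2)"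
    by (metis of_real_commute_quat mult.assoc quat_mult_cnj(2))
  finally have "qre (ip (x *\<^sub>Q a) (x *\<^sub>Q a)) = (nrm x * norm a)\<^sup>2"
    by (simp add: power_mult_distrib flip: of_real_mult of_real_power)
  then show ?thesis
    using x by (simp add: ip_norm_def [of ip "x *\<^sub>Q a"])
qed

lemma nrm_scale_real: "x \<in> V \<Longrightarrow> nrm (x *\<^sub>Q of_real t) = nrm x * \<bar>t\<bar>"
  by (simp add: nrm_scaleQ)

text \<open>With \<open>t\<close> real, no noncommuting scalar appears. This expansion feeds the
  Cauchy--Schwarz estimate, and in the Riesz proof the parallelogram law and the Euler
  equation.\<close>

lemma nrm_add_scale_sq:
  assumes "x \<in> V" "y \<in> V"
  shows "(nrm (x + y *\<^sub>Q of_real t))\<^sup>2 = (nrm x)\<^sup>2 + 2 * t * qre (ip x y) + t\<^sup>2 * (nrm y)\<^sup>2"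
proof -
  have "(nrm (x + y *\<^sub>Q of_real t))\<^sup>2
      = (nrm x)\<^sup>2 + t * qre (ip x y) + t * qre (ip y x) + t * (t * (nrm y)\<^sup>2)"
    using assms
    by (simp add: qre_ip_self [symmetric] ip_simps del: of_real_power) (simp add: algebra_simps)
  then show ?thesis
    using qre_ip_commute [OF assms] by (simp add: power2_eq_square algebra_simps)
qed

lemma qre_ip_le:
  assumes "x \<in> V" "y \<in> V"
  shows "qre (ip x y) \<le> nrm x * nrm y"
proof (cases "x = 0 \<or> y = 0")
  case True
  then show ?thesis
    using assms ip_scaleQ_right [of x y 0] ip_scaleQ_left [of x y 0] by auto
next
  case False
  then have pos: "0 < nrm x" "0 < nrm y"
    using assms nrm_eq_0 nrm_nonneg by (metis less_le)+
  \<comment> \<open>This scalar makes both square terms equal to \<open>(nrm x)\<^sup>2\<close>, so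
    the estimate follows without minimizing over \<open>t\<close>.\<close>
  have "0 \<le> (nrm (x + y *\<^sub>Q of_real (- (nrm x / nrm y))))\<^sup>2"
    by simp
  also have "\<dots> = 2 * (nrm x)\<^sup>2 - 2 * (nrm x / nrm y) * qre (ip x y)"
    using pos by (subst nrm_add_scale_sq [OF assms]) (simp add: power_divide)
  finally have "(nrm x / nrm y) * qre (ip x y) \<le> (nrm x)\<^sup>2"
    by simp
  then have "nrm x * qre (ip x y) \<le> nrm x * (nrm x * nrm y)"
    using pos by (simp add: field_simps power2_eq_square)
  then show ?thesis
    using pos by simp
qed

text \<open>Multiplying \<open>y\<close> on the right by the conjugate of \<open>ip x y\<close>
  makes the product real and equal to the squared norm, so the bound on real parts suffices.\<close>

lemma norm_ip_le:
  assumes "x \<in> V" "y \<in> V"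
  shows "norm (ip x y) \<le> nrm x * nrm y"
proof (cases "ip x y = 0")
  case False
  let ?a = "qcnj (ip x y)"
  have "(norm (ip x y))\<^sup>2 = qre (ip x (y *\<^sub>Q ?a))"
    using assms by (simp add: ip_simps quat_mult_cnj del: of_real_power)
  also have "\<dots> \<le> nrm x * nrm (y *\<^sub>Q ?a)"
    using assms by (intro qre_ip_le) auto
  also have "\<dots> = norm (ip x y) * (nrm x * nrm y)"
    using assms by (simp add: nrm_scaleQ)
  finally show ?thesis
    using False by (simp add: power2_eq_square)
qed (use assms in simp)

text \<open>Testing with \<open>x - x'\<close> itself. This gives the uniqueness behind the definite
  descriptions in \<open>adj\<close> and \<open>kernel_fun\<close>.\<close>

lemma ip_ext:
  assumes "x \<in> V" "x' \<in> V" and eq: "\<And>y. y \<in> V \<Longrightarrow> ip x y = ip x' y"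
  shows "x = x'"
  using ip_self_eq_0 [of "x - x'"] eq [of "x - x'"] assms by (simp add: ip_diff_left)

text \<open>
  The representing vector is the limit of a minimizing sequence of
  \<open>\<parallel>x\<parallel>\<^sup>2 - 2 Re \<phi>(x)\<close>, which is Cauchy by the parallelogram law. The Euler equation of the minimum
  only concerns real parts; right linearity recovers the other components.
\<close>

lemma riesz:
  fixes \<phi> :: "'a \<Rightarrow> quat"
  assumes add: "\<And>x y. x \<in> V \<Longrightarrow> y \<in> V \<Longrightarrow> \<phi> (x + y) = \<phi> x + \<phi> y"
    and scale: "\<And>x a. x \<in> V \<Longrightarrow> \<phi> (x *\<^sub>Q a) = \<phi> x * a"
    and bound: "\<And>x. x \<in> V \<Longrightarrow> norm (\<phi> x) \<le> C * nrm x"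
  obtains z where "z \<in> V" "\<And>x. x \<in> V \<Longrightarrow> \<phi> x = ip z x"
proof -
  define g where "g x = (nrm x)\<^sup>2 - 2 * qre (\<phi> x)" for x
  define m where "m = Inf (g ` V)"
  have "- C\<^sup>2 \<le> g x" if "x \<in> V" for x
  proof -
    have "qre (\<phi> x) \<le> C * nrm x"
      using abs_qre_le_norm [of "\<phi> x"] bound [OF that] by linarith
    moreover have "0 \<le> (nrm x - C)\<^sup>2"
      by simp
    ultimately show ?thesis
      by (simp add: g_def power2_diff mult.commute)
  qed
  then have bdd: "bdd_below (g ` V)"
    by (auto intro!: bdd_belowI)
  have m_le: "m \<le> g x" if "x \<in> V" for x
    unfolding m_def by (rule cInf_lower [OF _ bdd]) (use that in auto)
  have "\<exists>x\<in>V. g x < m + 1 / Suc n" for n :: nat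
  proof -
    have "\<exists>y\<in>g ` V. y < m + 1 / Suc n"
      unfolding m_def by (rule cInf_lessD) (auto intro: zero_mem)
    then show ?thesis
      by auto
  qed
  then obtain X where X: "\<And>n. X n \<in> V" "\<And>n. g (X n) < m + 1 / Suc n"
    by metis
  \<comment> \<open>Parallelogram law: the linear part of \<open>g\<close> cancels at the midpoint.
    Since \<open>g\<close> is at least \<open>m\<close> there, two near-minimizers must be close to
    each other.\<close>
  have half: "(nrm (x - y))\<^sup>2 = 2 * (g x + g y - 2 * g ((x + y) *\<^sub>Q of_real (1/2)))"
    if "x \<in> V" "y \<in> V" for x y
  proof -
    have "(nrm (x + y))\<^sup>2 = (nrm x)\<^sup>2 + 2 * qre (ip x y) + (nrm y)\<^sup>2"
      using nrm_add_scale_sq [OF that, of 1] by (simp add: scaleQ_one)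
    moreover have "(nrm (x - y))\<^sup>2 = (nrm x)\<^sup>2 - 2 * qre (ip x y) + (nrm y)\<^sup>2"
      using nrm_add_scale_sq [OF that, of "- 1"] by (simp add: scaleQ_minus_one)
    moreover have "(nrm ((x + y) *\<^sub>Q of_real (1/2)))\<^sup>2 = (nrm (x + y))\<^sup>2 / 4"
      using that by (subst nrm_scale_real) (auto simp: power_divide power_mult_distrib)
    moreover have "2 * qre (\<phi> ((x + y) *\<^sub>Q of_real (1/2))) = qre (\<phi> x) + qre (\<phi> y)"
      using that by (subst scale) (auto simp: add simp del: of_real_divide)
    ultimately show ?thesis
      unfolding g_def by argo
  qed
  have cauchy: "\<exists>N. \<forall>p\<ge>N. \<forall>q\<ge>N. nrm (X p - X q) < e" if "e > 0" for e
  proof -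
    \<comment> \<open>The estimate below ends in \<open>4 / Suc N\<close>, which has to fall under
      \<open>e\<^sup>2\<close>.\<close>
    obtain N :: nat where N: "4 / e\<^sup>2 < real N"
      using reals_Archimedean2 by blast
    have "nrm (X p - X q) < e" if "p \<ge> N" "q \<ge> N" for p q
    proof -
      have "(nrm (X p - X q))\<^sup>2 < 2 * (1 / Suc p + 1 / Suc q)"
        using half [of "X p" "X q"] X(1) [of p] X(1) [of q] X(2) [of p] X(2) [of q]
          m_le [of "(X p + X q) *\<^sub>Q of_real (1/2)"] by simp
      also have "\<dots> \<le> 2 * (1 / Suc N + 1 / Suc N)"
        using that by (intro mult_left_mono add_mono divide_left_mono) auto
      also have "\<dots> < e\<^sup>2"
        using N \<open>e > 0\<close> by (simp add: field_simps) (smt (verit) zero_less_power)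
      finally show ?thesis
        using \<open>e > 0\<close> by (simp add: power_less_imp_less_base)
    qed
    then show ?thesis
      by blast
  qed
  obtain z where z: "z \<in> V" and lim: "(\<lambda>n. nrm (X n - z)) \<longlonglongrightarrow> 0"
    using complete [of X] X(1) cauchy by blast
  have euler: "qre (ip z y) = qre (\<phi> y)" if y: "y \<in> V" for y
  proof -
    define d where "d = qre (ip z y) - qre (\<phi> y)"
    define N where "N = (nrm y)\<^sup>2"
    have quadratic: "0 \<le> t\<^sup>2 * N + 2 * t * d" for t
    proof -
      have lim_ip: "(\<lambda>n. qre (ip (X n) y)) \<longlonglongrightarrow> qre (ip z y)"
      proof (rule Lim_null_comparison [THEN LIM_zero_cancel])
        show "\<forall>\<^sub>F n in sequentially. norm (qre (ip (X n) y) - qre (ip z y)) \<le> nrm (X n - z) * nrm y"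
        proof (intro always_eventually allI)
          fix n
          have "norm (qre (ip (X n) y) - qre (ip z y)) = \<bar>qre (ip (X n - z) y)\<bar>"
            using X(1) y z by (simp add: ip_simps)
          also have "\<dots> \<le> nrm (X n - z) * nrm y"
            by (rule order_trans [OF abs_qre_le_norm norm_ip_le [OF diff_mem [OF X(1) z] y]])
          finally show "norm (qre (ip (X n) y) - qre (ip z y)) \<le> nrm (X n - z) * nrm y" .
        qed
        show "(\<lambda>n. nrm (X n - z) * nrm y) \<longlonglongrightarrow> 0"
          using tendsto_mult_right [OF lim, of "nrm y"] by simp
      qed
      \<comment> \<open>The variation is made at \<open>X n\<close>, where \<open>g\<close> exceeds
        \<open>m\<close> by less than \<open>1 / Suc n\<close>; letting n grow then gives the
        inequality at \<open>z\<close>.\<close>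
      have ge: "- (1 / Suc n) \<le> t\<^sup>2 * N + 2 * t * (qre (ip (X n) y) - qre (\<phi> y))" for n
      proof -
        have "m \<le> g (X n + y *\<^sub>Q of_real t)"
          using X(1) y by (intro m_le) auto
        also have "\<dots> = g (X n) + t\<^sup>2 * N + 2 * t * (qre (ip (X n) y) - qre (\<phi> y))"
          using X(1) y by (simp add: g_def N_def nrm_add_scale_sq add scale algebra_simps)
        finally show ?thesis
          using X(2) [of n] by linarith
      qed
      have lim0: "(\<lambda>n. - (1 / real (Suc n))) \<longlonglongrightarrow> - 0"
        using LIMSEQ_inverse_real_of_nat by (intro tendsto_minus) (simp add: inverse_eq_divide)
      have lim_d: "(\<lambda>n. t\<^sup>2 * N + 2 * t * (qre (ip (X n) y) - qre (\<phi> y)))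
          \<longlonglongrightarrow> t\<^sup>2 * N + 2 * t * d"
        unfolding d_def by (intro tendsto_intros lim_ip)
      show ?thesis
        using LIMSEQ_le [OF lim0 lim_d] ge by simp
    qed
    have N: "0 \<le> N"
      by (simp add: N_def)
    \<comment> \<open>Inserting \<open>t = - e\<close> makes the quadratic equal to
      \<open>- (e\<^sup>2 * (N + 2))\<close>. The added 1 keeps the denominator positive when
      \<open>y = 0\<close>.\<close>
    define e where "e = d / (N + 1)"
    have d: "d = (N + 1) * e"
      using N by (simp add: e_def)
    have "0 \<le> - (e\<^sup>2 * (N + 2))"
      using quadratic [of "- e"] by (simp add: d power2_eq_square algebra_simps)
    then have "e\<^sup>2 * (N + 2) \<le> 0"
      by simp
    then have "e = 0"
      using N by (simp add: mult_le_0_iff)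
    then show ?thesis
      using d by (simp add: d_def)
  qed
  have "\<phi> x = ip z x" if x: "x \<in> V" for x
  proof -
    \<comment> \<open>Scaling \<open>x\<close> by the conjugate of the defect turns the vanishing
      real part into the vanishing of the defect's squared norm.\<close>
    define a where "a = qcnj (\<phi> x - ip z x)"
    have "qre ((\<phi> x - ip z x) * a) = 0"
      using euler [of "x *\<^sub>Q a"] x z by (simp add: ip_simps scale left_diff_distrib)
    then show ?thesis
      unfolding a_def by (simp add: quat_mult_cnj del: of_real_power)
  qed
  with z show ?thesis
    using that by blast
qed

section \<open>Bounded operators, adjoints and the operator norm\<close>

lemma bounded_opsD:
  assumes "T \<in> bounded_ops V ip"
  shows "x \<in> V \<Longrightarrow> T x \<in> V"
    and "x \<in> V \<Longrightarrow> y \<in> V \<Longrightarrow> T (x + y) = T x + T y"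
    and "x \<in> V \<Longrightarrow> T (x *\<^sub>Q a) = T x *\<^sub>Q a"
  using assms by (auto simp: bounded_ops_def)

text \<open>The functional \<open>ip x (T y)\<close> of \<open>y\<close> is right linear and, by
  Cauchy--Schwarz, bounded, so Riesz represents it.\<close>

lemma adj_props:
  assumes T: "T \<in> bounded_ops V ip" and x: "x \<in> V"
  shows "adj V ip T x \<in> V" and "y \<in> V \<Longrightarrow> ip (adj V ip T x) y = ip x (T y)"
proof -
  obtain C where C: "\<And>y. y \<in> V \<Longrightarrow> nrm (T y) \<le> C * nrm y"
    using T unfolding bounded_ops_def by blast
  have "norm (ip x (T y)) \<le> (nrm x * C) * nrm y" if "y \<in> V" for y
  proof -
    have "norm (ip x (T y)) \<le> nrm x * nrm (T y)"
      by (rule norm_ip_le [OF x bounded_opsD(1) [OF T that]])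
    also have "\<dots> \<le> nrm x * (C * nrm y)"
      using x that by (intro mult_left_mono C) auto
    finally show ?thesis
      by (simp add: mult.assoc)
  qed
  then obtain z where z: "z \<in> V" "\<And>y. y \<in> V \<Longrightarrow> ip x (T y) = ip z y"
    using riesz [of "\<lambda>y. ip x (T y)" "nrm x * C"] T x
    by (auto simp: bounded_opsD ip_simps)
  have "adj V ip T x = (THE z. z \<in> V \<and> (\<forall>y\<in>V. ip z y = ip x (T y)))"
    using x by (simp add: adj_def)
  also have "\<dots> = z"
    using z by (intro the_equality) (auto intro: ip_ext)
  finally show "adj V ip T x \<in> V" "y \<in> V \<Longrightarrow> ip (adj V ip T x) y = ip x (T y)"
    using z by auto
qed

lemma norm_ip_le_op_norm:
  assumes T: "T \<in> bounded_ops V ip" and x: "x \<in> V" "nrm x \<le> 1"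
  shows "norm (ip x (T x)) \<le> op_norm V ip T"
proof -
  obtain C where C: "\<And>y. y \<in> V \<Longrightarrow> nrm (T y) \<le> C * nrm y"
    using T unfolding bounded_ops_def by blast
  \<comment> \<open>No sign is prescribed for \<open>C\<close>, hence the absolute value. The bound
    on the unit ball makes the real supremum in \<open>op_norm\<close> meaningful.\<close>
  have "nrm (T y) \<le> \<bar>C\<bar>" if "y \<in> V" "nrm y \<le> 1" for y
  proof -
    have "nrm (T y) \<le> \<bar>C\<bar> * nrm y"
      using C [OF that(1)] mult_right_mono [OF abs_ge_self nrm_nonneg [OF that(1)], of C]
      by linarith
    also have "\<dots> \<le> \<bar>C\<bar>"
      using that by (intro mult_left_le) auto
    finally show ?thesis .
  qed
  then have "bdd_above ((\<lambda>x. nrm (T x)) ` {x \<in> V. nrm x \<le> 1})"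
    by (intro bdd_aboveI [of _ "\<bar>C\<bar>"]) auto
  then have "nrm (T x) \<le> op_norm V ip T"
    unfolding op_norm_def using x by (intro cSUP_upper) auto
  moreover have "norm (ip x (T x)) \<le> nrm x * nrm (T x)"
    by (rule norm_ip_le [OF x(1) bounded_opsD(1) [OF T x(1)]])
  moreover have "nrm x * nrm (T x) \<le> nrm (T x)"
    using x bounded_opsD(1) [OF T] by (simp add: mult_left_le_one_le)
  ultimately show ?thesis
    by linarith
qed

end


section \<open>Measurability on the diagonal\<close>

text \<open>Simple functions \<open>s n\<close> approximate the identity. Each
  \<open>F (s n x) x\<close> involves finitely many sections \<open>F p\<close>, and continuity in
  the first argument carries measurability to the limit.\<close>

lemma borel_measurable_diagonal:
  fixes F :: "'a::{metric_space, second_countable_topology} \<Rightarrow> 'a \<Rightarrow> 'b::{metric_space, zero}"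
  assumes id: "(\<lambda>x. x) \<in> borel_measurable M" and S: "open S" "space M \<subseteq> S"
    and meas: "\<And>p. p \<in> S \<Longrightarrow> F p \<in> borel_measurable M"
    and cont: "\<And>q. q \<in> space M \<Longrightarrow> continuous_on S (\<lambda>p. F p q)"
  shows "(\<lambda>x. F x x) \<in> borel_measurable M"
proof -
  \<comment> \<open>The point \<open>undefined\<close> is an arbitrary base point; the argument
    rests on simplicity and pointwise convergence.\<close>
  obtain s where s: "\<And>n. simple_function M (s n)"
    and lim: "\<And>x. x \<in> space M \<Longrightarrow> (\<lambda>n. s n x) \<longlonglongrightarrow> x"
    using borel_measurable_implies_sequence_metric [OF id, of undefined] by blast
  \<comment> \<open>An approximant may take values outside \<open>S\<close>, where nothing is known
    about \<open>F\<close>. As \<open>S\<close> is open, for each \<open>x\<close> this happens only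
    for finitely many n.\<close>
  define G where "G p x = (if p \<in> S then F p x else 0)" for p x
  show ?thesis
  proof (rule borel_measurable_LIMSEQ_metric)
    fix n
    show "(\<lambda>x. G (s n x) x) \<in> borel_measurable M"
    proof (rule measurable_compose_countable' [where f = G and g = "s n"])
      show "s n \<in> measurable M (count_space (s n ` space M))"
        using simple_functionD [OF s] by (auto simp: measurable_count_space_eq2)
      show "countable (s n ` space M)"
        using s by (simp add: simple_function_def countable_finite)
      show "G p \<in> borel_measurable M" if "p \<in> s n ` space M" for p
        by (cases "p \<in> S") (auto simp: G_def [abs_def] meas)
    qed
  next
    fix x assume x: "x \<in> space M"
    have "\<forall>\<^sub>F n in sequentially. s n x \<in> S"
      using lim [OF x] S x by (auto intro: topological_tendstoD)
    then have "\<forall>\<^sub>F n in sequentially. F (s n x) x = G (s n x) x"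
      by eventually_elim (simp add: G_def)
    moreover have "isCont (\<lambda>p. F p x) x"
      using cont [OF x] S x by (auto simp: continuous_on_eq_continuous_at)
    then have "(\<lambda>n. F (s n x) x) \<longlonglongrightarrow> F x x"
      using lim [OF x] by (rule isCont_tendsto_compose)
    ultimately show "(\<lambda>n. G (s n x) x) \<longlonglongrightarrow> F x x"
      by (rule Lim_transform_eventually [rotated])
  qed
qed


section \<open>Kernel functions and the Berezin transform\<close>

locale slice_rkhs_space =
  fixes H :: "(quat \<Rightarrow> quat) set" and ip :: "(quat \<Rightarrow> quat) \<Rightarrow> (quat \<Rightarrow> quat) \<Rightarrow> quat"
  assumes rkhs: "slice_rkhs H ip"
    and kernel_pos: "\<forall>q\<in>qdisc. rep_kernel H ip q q \<in> \<real>\<^sub>\<ge>\<^sub>0 \<and> rep_kernel H ip q q \<noteq> 0"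
begin

sublocale quat_hilbert H ip
  using rkhs by unfold_locales (simp add: slice_rkhs_def)

abbreviation K :: "quat \<Rightarrow> quat \<Rightarrow> quat" where
  "K \<equiv> kernel_fun H ip"

text \<open>Real differentiability is part of slice hyperholomorphy; the resulting continuity drives
  the measurability argument.\<close>

lemma continuous_on_qdisc: "f \<in> H \<Longrightarrow> continuous_on qdisc f"
  using rkhs
  by (auto simp: slice_rkhs_def left_slice_hyperholomorphic_def
      intro!: continuous_at_imp_continuous_on differentiable_imp_continuous_within)

text \<open>Riesz representation of the bounded point evaluation at \<open>w\<close>.\<close>

lemma kernel_props:
  assumes w: "w \<in> qdisc"
  shows "K w \<in> H" and "f \<in> H \<Longrightarrow> ip (K w) f = f w"
proof -
  obtain C where C: "\<And>f. f \<in> H \<Longrightarrow> norm (f w) \<le> C * nrm f"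
    using rkhs w unfolding slice_rkhs_def by blast
  obtain k where k: "k \<in> H" "\<And>f. f \<in> H \<Longrightarrow> f w = ip k f"
    using riesz [of "\<lambda>f. f w" C] C by (auto simp: scaleQ_fun_def scaleQ_quat_def)
  have "K w = k"
    unfolding kernel_fun_def using k
    by (intro the_equality) (auto intro!: ip_ext)
  then show "K w \<in> H" "f \<in> H \<Longrightarrow> ip (K w) f = f w"
    using k by auto
qed

text \<open>Writing the normalizing factor through \<open>ip (K q) (K q)\<close> makes its
  measurability the identity-operator case of the diagonal argument.\<close>

definition c :: "quat \<Rightarrow> real" where
  "c q = 1 / sqrt (qre (ip (K q) (K q)))"

lemma normalized_kernel_eq:
  "q \<in> qdisc \<Longrightarrow> normalized_kernel_fun H ip q = K q *\<^sub>Q of_real (c q)"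
  by (simp add: normalized_kernel_fun_def rep_kernel_def c_def kernel_props)

lemma normalized_kernel_mem: "q \<in> qdisc \<Longrightarrow> normalized_kernel_fun H ip q \<in> H"
  by (simp add: normalized_kernel_eq kernel_props)

text \<open>Positivity of the kernel on the diagonal enters here, to exclude
  \<open>K q = 0\<close>.\<close>

lemma nrm_normalized_kernel:
  assumes q: "q \<in> qdisc"
  shows "nrm (normalized_kernel_fun H ip q) = 1"
proof -
  have "ip (K q) (K q) \<noteq> 0"
    using q kernel_pos by (simp add: rep_kernel_def kernel_props)
  then have "0 < nrm (K q)"
    using q kernel_props(1) ip_self_eq_0 nrm_eq_0 nrm_nonneg by (metis less_le)
  moreover have "c q = 1 / nrm (K q)"
    by (simp add: c_def ip_norm_def)
  ultimately show ?thesis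
    using q by (simp add: normalized_kernel_eq kernel_props nrm_scale_real del: of_real_divide)
qed

text \<open>The real factor \<open>c q\<close> is central and leaves both slots. This separates the
  normalization from the diagonal term whose measurability is studied.\<close>

lemma berezin_eq:
  assumes "T \<in> bounded_ops H ip" "q \<in> qdisc"
  shows "berezin H ip T q = of_real ((c q)\<^sup>2) * ip (K q) (T (K q))"
proof -
  have "berezin H ip T q = of_real (c q) * (ip (K q) (T (K q)) * of_real (c q))"
    using assms
    by (simp add: berezin_def normalized_kernel_eq kernel_props bounded_opsD ip_simps mult.assoc)
  then show ?thesis
    by (simp add: of_real_commute_quat [of "ip x y" for x y] power2_eq_square mult.assoc)
qed

text \<open>
  The function \<open>\<langle>K\<^sub>p, T K\<^sub>q\<rangle>\<close> is separately continuous: it equals \<open>(T K\<^sub>q)(p)\<close> and is the conjugate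
  of \<open>(T\<^sup>* K\<^sub>p)(q)\<close>. No continuity of \<open>q \<mapsto> K\<^sub>q\<close> in norm is needed.
\<close>

lemma measurable_kernel_diagonal:
  assumes T: "\<And>x. x \<in> H \<Longrightarrow> T x \<in> H"
    and T': "\<And>x. x \<in> H \<Longrightarrow> T' x \<in> H" "\<And>x y. x \<in> H \<Longrightarrow> y \<in> H \<Longrightarrow> ip (T' x) y = ip x (T y)"
    and i: "i \<in> imag_units"
  shows "(\<lambda>z. ip (K (slice_embed i z)) (T (K (slice_embed i z))))
    \<in> borel_measurable (lebesgue_on (ball 0 1))"
proof (rule borel_measurable_diagonal [where S = "ball 0 1" and
      F = "\<lambda>p q. ip (K (slice_embed i p)) (T (K (slice_embed i q)))"])
  have in_disc: "slice_embed i z \<in> qdisc" if "z \<in> ball 0 1" for z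
    using that norm_slice_embed [OF i] by (simp add: qdisc_def)
  have cont: "continuous_on (ball 0 1) (\<lambda>z. f (slice_embed i z))" if "f \<in> H" for f
    by (rule continuous_on_compose2 [OF continuous_on_qdisc [OF that] continuous_on_slice_embed])
      (use in_disc in auto)
  show "(\<lambda>x. x) \<in> borel_measurable (lebesgue_on (ball (0::complex) 1))"
    by (intro continuous_imp_measurable_on_sets_lebesgue continuous_intros) simp
  show "(\<lambda>q. ip (K (slice_embed i p)) (T (K (slice_embed i q))))
      \<in> borel_measurable (lebesgue_on (ball 0 1))" if p: "p \<in> ball 0 1" for p
  proof (intro continuous_imp_measurable_on_sets_lebesgue)
    have "ip (K (slice_embed i p)) (T (K (slice_embed i q)))
        = qcnj (T' (K (slice_embed i p)) (slice_embed i q))" if q: "q \<in> ball 0 1" for q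
    proof -
      have Kp: "K (slice_embed i p) \<in> H" and Kq: "K (slice_embed i q) \<in> H"
        using p q in_disc kernel_props(1) by blast+
      have "ip (K (slice_embed i p)) (T (K (slice_embed i q)))
          = ip (T' (K (slice_embed i p))) (K (slice_embed i q))"
        by (simp add: T'(2) Kp Kq)
      also have "\<dots> = qcnj (ip (K (slice_embed i q)) (T' (K (slice_embed i p))))"
        by (intro ip_cnj T'(1) Kp Kq)
      finally show ?thesis
        by (simp only: kernel_props(2) [OF in_disc [OF q] T'(1) [OF Kp]])
    qed
    moreover have "continuous_on (ball 0 1) (\<lambda>q. qcnj (T' (K (slice_embed i p)) (slice_embed i q)))"
      by (intro bounded_linear.continuous_on [OF bounded_linear_qcnj] cont T'(1)
          kernel_props(1) in_disc p)
    ultimately show "continuous_on (ball 0 1)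
        (\<lambda>q. ip (K (slice_embed i p)) (T (K (slice_embed i q))))"
      by (metis (no_types, lifting) continuous_on_cong)
  qed simp
  show "continuous_on (ball 0 1) (\<lambda>p. ip (K (slice_embed i p)) (T (K (slice_embed i q))))"
    if "q \<in> space (lebesgue_on (ball 0 1))" for q
  proof -
    have TK: "T (K (slice_embed i q)) \<in> H"
      using that by (intro T kernel_props in_disc) (simp add: space_restrict_space)
    have "ip (K (slice_embed i p)) (T (K (slice_embed i q))) = T (K (slice_embed i q)) (slice_embed i p)"
      if "p \<in> ball 0 1" for p
      using TK in_disc [OF that] by (simp add: kernel_props)
    with cont [OF TK] show ?thesis
      by (metis (no_types, lifting) continuous_on_cong)
  qed
qed (auto simp: space_restrict_space)

text \<open>After pulling back to the complex disc, both factors of \<open>berezin_eq\<close> are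
  handled by the diagonal lemma: once with \<open>T\<close> and its adjoint, once with the identity
  in both roles.\<close>

lemma measurable_berezin:
  assumes T: "T \<in> bounded_ops H ip" and i: "i \<in> imag_units"
  shows "berezin H ip T \<in> borel_measurable (slice_lebesgue i)"
  unfolding slice_lebesgue_def
proof (rule measurable_embed_measure1)
  let ?M = "lebesgue_on (ball (0::complex) 1)" and ?e = "slice_embed i"
  have [measurable]: "(\<lambda>z. ip (K (?e z)) (T (K (?e z)))) \<in> borel_measurable ?M"
    by (rule measurable_kernel_diagonal [where T' = "adj H ip T"])
      (use T i in \<open>auto simp: bounded_opsD adj_props\<close>)
  have [measurable]: "(\<lambda>z. ip (K (?e z)) (K (?e z))) \<in> borel_measurable ?M"
    by (rule measurable_kernel_diagonal [where T' = "\<lambda>x. x"]) (use i in auto)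
  have [measurable]: "qre \<in> borel_measurable borel"
    by (intro borel_measurable_continuous_onI continuous_on_qre)
  have meas: "(\<lambda>z. of_real ((c (?e z))\<^sup>2) * ip (K (?e z)) (T (K (?e z)))) \<in> borel_measurable ?M"
    unfolding c_def by measurable
  have eq: "berezin H ip T (?e z) = of_real ((c (?e z))\<^sup>2) * ip (K (?e z)) (T (K (?e z)))"
    if "z \<in> space ?M" for z
    by (rule berezin_eq [OF T])
      (use that norm_slice_embed [OF i] in \<open>simp add: qdisc_def space_restrict_space\<close>)
  show "(\<lambda>z. berezin H ip T (?e z)) \<in> borel_measurable ?M"
    by (rule measurable_cong [THEN iffD2, OF eq meas])
qed

text \<open>The bound holds at every point of the slice disc, because the normalized kernels are
  unit vectors.\<close>

lemma Linf_norm_berezin_le: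
  assumes T: "T \<in> bounded_ops H ip" and i: "i \<in> imag_units"
  shows "Linf_norm (slice_lebesgue i) (berezin H ip T) \<le> ereal (op_norm H ip T)"
  unfolding Linf_norm_def
proof (rule esssup_I)
  show "(\<lambda>q. ereal (norm (berezin H ip T q))) \<in> borel_measurable (slice_lebesgue i)"
    using measurable_berezin [OF assms] by measurable
  show "AE q in slice_lebesgue i. ereal (norm (berezin H ip T q)) \<le> ereal (op_norm H ip T)"
    using T norm_ip_le_op_norm normalized_kernel_mem nrm_normalized_kernel
    by (intro AE_I2) (simp add: berezin_def space_slice_lebesgue [OF i] slice_disc_def)
qed

lemma berezin_adj:
  assumes T: "T \<in> bounded_ops H ip" and q: "q \<in> qdisc"
  shows "berezin H ip (adj H ip T) q = qcnj (berezin H ip T q)"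
proof -
  let ?k = "normalized_kernel_fun H ip q"
  have k: "?k \<in> H"
    using q by (rule normalized_kernel_mem)
  have "ip ?k (adj H ip T ?k) = qcnj (ip (adj H ip T ?k) ?k)"
    by (rule ip_cnj [OF k adj_props(1) [OF T k]])
  then show ?thesis
    by (simp add: berezin_def adj_props(2) [OF T k k])
qed

text \<open>A scalar leaves the first slot on the left and conjugated; the sign from
  anti-selfadjointness undoes the conjugation of the imaginary unit \<open>i\<close>.\<close>

lemma ip_J_eq:
  assumes J: "J \<in> bounded_ops H ip" "anti_selfadjoint_op H ip J"
    and i: "i \<in> imag_units" and x: "x \<in> plus_eigenspace H J i" and y: "y \<in> H"
  shows "ip x (J y) = i * ip x y"
proof -
  have xH: "x \<in> H" and Jx: "J x = x *\<^sub>Q i"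
    using x by (auto simp: plus_eigenspace_def)
  have "ip x (J y) = ip (- J x) y"
    using adj_props(2) [OF J(1) xH y] J(2) by (simp add: anti_selfadjoint_op_def)
  also have "\<dots> = - qcnj i * ip x y"
    using xH y by (simp add: Jx ip_simps)
  also have "- qcnj i = i"
    using i by (simp add: imag_units_def quat_eq_iff)
  finally show ?thesis .
qed

lemma normalized_kernel_eigen:
  assumes J: "J \<in> bounded_ops H ip"
    and span: "plus_eigenspace H J i = ip_closure H ip (slice_span i (K ` slice_disc i))"
    and q: "q \<in> slice_disc i"
  shows "normalized_kernel_fun H ip q \<in> plus_eigenspace H J i"
proof -
  have qd: "q \<in> qdisc"
    using q by (simp add: slice_disc_def)
  have "(1 :: quat) \<in> slice i"
    unfolding slice_def by (rule CollectI, rule exI [of _ 1], rule exI [of _ 0]) simp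
  \<comment> \<open>A one-term combination with coefficient 1, approximated in the closure by
    itself.\<close>
  then have "K q \<in> slice_span i (K ` slice_disc i)"
    unfolding slice_span_def using q
    by (intro CollectI exI [of _ "{K q}"] exI [of _ "\<lambda>_. 1"]) (simp add: scaleQ_one)
  then have "K q \<in> plus_eigenspace H J i"
    unfolding span ip_closure_def using kernel_props(1) [OF qd] nrm_zero
    by (auto intro!: bexI [of _ "K q"])
  \<comment> \<open>The eigenspace admits scalars that commute with \<open>i\<close>, and the
    normalizing factor is real.\<close>
  then show ?thesis
    using J kernel_props(1) [OF qd]
    by (simp add: normalized_kernel_eq [OF qd] plus_eigenspace_def bounded_opsD
        of_real_commute_quat [of i] flip: scaleQ_mult)
qed

end


section \<open>Properties of the Berezin transform\<close>

text \<open>Claim (iv) occupies the last four conjuncts: membership in \<open>Linf\<close>,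
  additivity, homogeneity over the slice, contractivity. Linearity is asserted at every point of
  \<open>slice_disc i\<close>, not merely almost everywhere.\<close>

theorem proposition4p4:
  fixes H :: "(quat \<Rightarrow> quat) set"
    and ip :: "(quat \<Rightarrow> quat) \<Rightarrow> (quat \<Rightarrow> quat) \<Rightarrow> quat"
    and J :: "(quat \<Rightarrow> quat) \<Rightarrow> (quat \<Rightarrow> quat)"
    and i :: quat
  assumes "slice_rkhs H ip"
    and "\<forall>q\<in>qdisc. rep_kernel H ip q q \<in> \<real>\<^sub>\<ge>\<^sub>0 \<and> rep_kernel H ip q q \<noteq> 0"
    and "i \<in> imag_units"
    and "J \<in> bounded_ops H ip" and "unitary_op H ip J" and "anti_selfadjoint_op H ip J"
    and "plus_eigenspace H J i =
           ip_closure H ip (slice_span i (kernel_fun H ip ` slice_disc i))"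
  shows "(\<forall>T\<in>commuting_ops H ip J. selfadjoint_op H ip T \<longrightarrow>
            (\<forall>q\<in>slice_disc i. berezin H ip T q \<in> \<real>)) \<and>
         (\<forall>T\<in>commuting_ops H ip J. positive_op H ip T \<longrightarrow>
            (\<forall>q\<in>slice_disc i. berezin H ip T q \<in> \<real>\<^sub>\<ge>\<^sub>0)) \<and>
         (\<forall>T\<in>commuting_ops H ip J. \<forall>q\<in>slice_disc i.
            berezin H ip (adj H ip T) q = qcnj (berezin H ip T q)) \<and>
         (\<forall>T\<in>commuting_ops H ip J. berezin H ip T \<in> Linf (slice_lebesgue i)) \<and>
         (\<forall>T\<in>commuting_ops H ip J. \<forall>S\<in>commuting_ops H ip J. \<forall>q\<in>slice_disc i.
            berezin H ip (T + S) q = berezin H ip T q + berezin H ip S q) \<and>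
         (\<forall>T\<in>commuting_ops H ip J. \<forall>a b. \<forall>q\<in>slice_disc i.
            berezin H ip (scale_op J a b T) q =
              (of_real a + i * of_real b) * berezin H ip T q) \<and>
         (\<forall>T\<in>commuting_ops H ip J.
            Linf_norm (slice_lebesgue i) (berezin H ip T) \<le> ereal (op_norm H ip T))"
proof -
  interpret slice_rkhs_space H ip
    using assms(1,2) by unfold_locales
  let ?k = "normalized_kernel_fun H ip"
  have k: "?k q \<in> H" if "q \<in> slice_disc i" for q
    using that by (simp add: normalized_kernel_mem slice_disc_def)
  have bd: "T \<in> bounded_ops H ip" if "T \<in> commuting_ops H ip J" for T
    using that by (simp add: commuting_ops_def)
  have adj: "berezin H ip (adj H ip T) q = qcnj (berezin H ip T q)"
    if "T \<in> commuting_ops H ip J" "q \<in> slice_disc i" for T q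
    using that by (intro berezin_adj bd) (simp_all add: slice_disc_def)
  have real: "berezin H ip T q \<in> \<real>"
    if "T \<in> commuting_ops H ip J" "selfadjoint_op H ip T" "q \<in> slice_disc i" for T q
    using adj [OF that(1,3)] that(2) by (simp add: selfadjoint_op_def Reals_iff_qcnj_eq)
  have pos: "berezin H ip T q \<in> \<real>\<^sub>\<ge>\<^sub>0" if "positive_op H ip T" "q \<in> slice_disc i" for T q
    using that k by (simp add: positive_op_def berezin_def)
  have contractive: "Linf_norm (slice_lebesgue i) (berezin H ip T) \<le> ereal (op_norm H ip T)"
    if "T \<in> commuting_ops H ip J" for T
    using bd [OF that] assms(3) by (rule Linf_norm_berezin_le)
  have Linf: "berezin H ip T \<in> Linf (slice_lebesgue i)" if "T \<in> commuting_ops H ip J" for T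
    unfolding Linf_def
    using measurable_berezin [OF bd [OF that] assms(3)] contractive [OF that]
    by (auto intro: le_less_trans)
  have add: "berezin H ip (T + S) q = berezin H ip T q + berezin H ip S q"
    if "T \<in> commuting_ops H ip J" "S \<in> commuting_ops H ip J" "q \<in> slice_disc i" for T S q
    using bounded_opsD(1) [OF bd] that k by (simp add: berezin_def ip_add_right)
  have scale: "berezin H ip (scale_op J a b T) q = (of_real a + i * of_real b) * berezin H ip T q"
    if T: "T \<in> commuting_ops H ip J" and q: "q \<in> slice_disc i" for T a b q
  proof -
    have TH: "T (?k q) \<in> H"
      using bounded_opsD(1) [OF bd [OF T]] k [OF q] by blast
    have "berezin H ip (scale_op J a b T) q
        = ip (?k q) (T (?k q)) * of_real a + ip (?k q) (J (T (?k q))) * of_real b"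
      using TH bounded_opsD(1) [OF assms(4)] k [OF q]
      by (simp add: berezin_def scale_op_def ip_linear)
    also have "ip (?k q) (J (T (?k q))) = i * ip (?k q) (T (?k q))"
      by (rule ip_J_eq [OF assms(4,6,3) normalized_kernel_eigen [OF assms(4,7) q] TH])
    \<comment> \<open>The coefficients \<open>a\<close> and \<open>b\<close> appear on the right;
      being real, they move to the left past the inner product.\<close>
    finally show ?thesis
      by (simp add: berezin_def distrib_right mult.assoc of_real_commute_quat [of "ip x y" for x y])
  qed
  show ?thesis
    using real pos adj Linf add scale contractive by blast
qed

end
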